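(* There exists a meromorphic function $f$ on $\mathbb{C}$ of infinite order such that, for all sufficiently large $r$, $$\frac{N\big(r,f(z+1)\big)-N\big(r,f(z)\big)}{N\big(r,f(z)\big)}\ge 1 .$$
   Context: Meromorphic means meromorphic in the whole complex plane. $n(t,f)$ is the number of poles of $f$ in $|z|\le t$, with multiplicity; $N(r,f)=\int_0^r\frac{n(t,f)-n(0,f)}{t}\,dt+n(0,f)\log r$; $N(r,f(z+1))$ is the counting function of $z\mapsto f(z+1)$. With $m(r,f)=\frac1{2\pi}\int_0^{2\pi}\log^+|f(re^{i\theta})|\,d\theta$ and $T(r,f)=m(r,f)+N(r,f)$, the order of $f$ is $\limsup_{r\to\infty}\frac{\log^+T(r,f)}{\log r}$. *)

theory Defs
  imports "HOL-Complex_Analysis.Complex_Analysis"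
begin

(* Equals max 0 (ln x) for x > 0, and yields 0 for x = 0. *)
definition log_plus :: "real \<Rightarrow> real" where
  "log_plus x = ln (max 1 x)"

(* A pole z of f has multiplicity - zorder f z. *)
definition pole_count :: "real \<Rightarrow> (complex \<Rightarrow> complex) \<Rightarrow> nat" where
  "pole_count t f = (\<Sum>z\<in>{z. norm z \<le> t \<and> is_pole f z}. nat (- zorder f z))"

definition counting_N :: "real \<Rightarrow> (complex \<Rightarrow> complex) \<Rightarrow> real" where
  "counting_N r f =
     integral {0..r} (\<lambda>t. (real (pole_count t f) - real (pole_count 0 f)) / t)
       + real (pole_count 0 f) * ln r"

(* For f meromorphic, the integrand has at most logarithmic singularities (at poles on the
   circle), so the integral exists and is not affected by the values given to f at its poles. *)
definition proximity_m :: "real \<Rightarrow> (complex \<Rightarrow> complex) \<Rightarrow> real" where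
  "proximity_m r f =
     1 / (2 * pi) * integral {0..2 * pi} (\<lambda>\<theta>. log_plus (norm (f (complex_of_real r * cis \<theta>))))"

definition characteristic_T :: "real \<Rightarrow> (complex \<Rightarrow> complex) \<Rightarrow> real" where
  "characteristic_T r f = proximity_m r f + counting_N r f"

definition growth_order :: "(complex \<Rightarrow> complex) \<Rightarrow> ereal" where
  "growth_order f = Limsup at_top (\<lambda>r::real. ereal (log_plus (characteristic_T r f) / ln r))"

end

(* Let f be the reciprocal of a Weierstrass product, with a pole of order 2^(k-1) at each integer
   k >= 2 and no others. The pole at k of order m k contributes m k * ln (r / k) to N(r, f), and the
   shift moves a pole of order m (k + 1) >= 2 * m k to k, so N(r, f(z+1)) >= 2 * N(r, f). Already
   the single pole near r / 2 makes N(r, f), hence T(r, f), grow exponentially. *)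
theory Submission
  imports Defs "HOL-Library.Log_Nat" "HOL-Real_Asymp.Real_Asymp"
begin

section \<open>Counting functions when all poles are natural numbers\<close>

definition poles_on_nat :: "(complex \<Rightarrow> complex) \<Rightarrow> (nat \<Rightarrow> nat) \<Rightarrow> bool" where
  "poles_on_nat f m \<longleftrightarrow>
     (\<forall>z. is_pole f z \<longleftrightarrow> (\<exists>k. z = of_nat k \<and> m k > 0)) \<and>
     (\<forall>k. m k > 0 \<longrightarrow> zorder f (of_nat k) = - int (m k))"

text \<open>The condition \<open>m 0 = 0\<close> keeps the shifted poles among the naturals: a pole
  at 0 would move to -1.\<close>

lemma poles_on_nat_shift:
  assumes "poles_on_nat f m" "m 0 = 0"
  shows "poles_on_nat (\<lambda>z. f (z + 1)) (\<lambda>k. m (Suc k))"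
proof -
  have pole: "is_pole (\<lambda>z. f (z + 1)) z \<longleftrightarrow> is_pole f (z + 1)" for z
    using is_pole_shift_iff[of f 1 z] by (simp add: o_def add.commute)
  have ord: "zorder (\<lambda>z. f (z + 1)) z = zorder f (z + 1)" for z
    using zorder_shift[of "\<lambda>z. f (z + 1)" z] zorder_shift[of f "z + 1"] by (simp add: add.assoc)
  have "(\<exists>k. z + 1 = of_nat k \<and> m k > 0) \<longleftrightarrow> (\<exists>k. z = of_nat k \<and> m (Suc k) > 0)" for z :: complex
    using assms(2) by (metis add.commute add_right_cancel bot_nat_0.not_eq_extremum of_nat_Suc
        old.nat.exhaust)
  moreover have "zorder f (of_nat k + 1) = - int (m (Suc k))" if "m (Suc k) > 0" for k
    using assms(1) that unfolding poles_on_nat_def by (metis of_nat_Suc add.commute)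
  ultimately show ?thesis
    using assms(1) unfolding poles_on_nat_def pole ord by simp
qed

text \<open>The index range depends on \<open>n\<close> but not on \<open>t\<close>, so a single
  \<open>n\<close> serves all radii t \<le> r, and the integral defining \<open>counting_N\<close>
  can be exchanged with a finite sum.\<close>

lemma pole_count_poles_on_nat:
  assumes "poles_on_nat f m" "m 0 = 0" "t \<ge> 0" "t < real (Suc n)"
  shows "pole_count t f = (\<Sum>k=1..n. if real k \<le> t then m k else 0)"
proof -
  let ?K = "{k. real k \<le> t \<and> m k > 0}"
  have "{z. norm z \<le> t \<and> is_pole f z} = of_nat ` ?K"
    using assms(1) unfolding poles_on_nat_def by auto
  hence "pole_count t f = (\<Sum>k\<in>?K. nat (- zorder f (of_nat k)))"
    unfolding pole_count_def by (simp add: sum.reindex inj_on_def)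
  also have "\<dots> = (\<Sum>k\<in>?K. if real k \<le> t then m k else 0)"
    using assms(1) unfolding poles_on_nat_def by (intro sum.cong) auto
  also have "\<dots> = (\<Sum>k=1..n. if real k \<le> t then m k else 0)"
  proof (rule sum.mono_neutral_left)
    show "?K \<subseteq> {1..n}"
    proof
      fix k assume k: "k \<in> ?K"
      hence "k \<noteq> 0" using assms(2) by (intro notI) auto
      moreover have "real k < real (Suc n)" using k assms(4) by simp
      ultimately show "k \<in> {1..n}" by auto
    qed
  qed auto
  finally show ?thesis .
qed

lemma has_integral_inverse_ln:
  assumes "0 < a" "a \<le> (b :: real)"
  shows "((\<lambda>t. 1 / t) has_integral ln (b / a)) {a..b}"
proof -
  have "((\<lambda>t. 1 / t) has_integral (ln b - ln a)) {a..b}"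
    using assms
    by (intro fundamental_theorem_of_calculus)
      (auto intro!: derivative_eq_intros simp flip: has_real_derivative_iff_has_vector_derivative)
  thus ?thesis using assms by (simp add: ln_div)
qed

text \<open>As a function of t, the pole at k adds \<open>m k / t\<close> on [k, r] and nothing
  before, which integrates to \<open>m k * ln (r / k)\<close>. Without a pole at the origin, the
  terms with n(0, f) vanish and the integrand is 0 near t = 0.\<close>

lemma counting_N_poles_on_nat:
  assumes "poles_on_nat f m" "m 0 = 0" "r > 0"
  shows "counting_N r f = (\<Sum>k=1..nat \<lfloor>r\<rfloor>. real (m k) * ln (r / real k))"
proof -
  define n where "n = nat \<lfloor>r\<rfloor>"
  have n: "r < Suc n" "\<And>k. k \<le> n \<Longrightarrow> real k \<le> r"
    unfolding n_def using assms(3) by linarith+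
  have count0: "pole_count 0 f = 0"
    using pole_count_poles_on_nat[OF assms(1,2), of 0 0] by simp
  have "((\<lambda>t. \<Sum>k=1..n. real (m k) * (if t \<in> {real k..r} then 1 / t else 0))
      has_integral (\<Sum>k=1..n. real (m k) * ln (r / real k))) {0..r}"
  proof (intro has_integral_sum has_integral_mult_right)
    fix k assume k: "k \<in> {1..n}"
    have "((\<lambda>t. 1 / t) has_integral ln (r / real k)) {real k..r}"
      using k n(2)[of k] by (intro has_integral_inverse_ln) auto
    thus "((\<lambda>t. if t \<in> {real k..r} then 1 / t else 0) has_integral ln (r / real k)) {0..r}"
      by (subst has_integral_restrict) auto
  qed auto
  \<comment> \<open>At t = 0 both sides are 0: no k \<ge> 1 satisfies k \<le> 0, and the numerator
    on the right vanishes.\<close>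
  moreover have "(\<Sum>k=1..n. real (m k) * (if t \<in> {real k..r} then 1 / t else 0)) =
      (real (pole_count t f) - real (pole_count 0 f)) / t" if "t \<in> {0..r}" for t
  proof -
    have "pole_count t f = (\<Sum>k=1..n. if real k \<le> t then m k else 0)"
      using that n(1) by (simp add: pole_count_poles_on_nat[OF assms(1,2), of t n])
    thus ?thesis
      using that by (auto simp: count0 sum_divide_distrib intro!: sum.cong)
  qed
  ultimately have "((\<lambda>t. (real (pole_count t f) - real (pole_count 0 f)) / t)
      has_integral (\<Sum>k=1..n. real (m k) * ln (r / real k))) {0..r}"
    by (rule has_integral_eq[rotated])
  thus ?thesis
    unfolding counting_N_def count0 n_def by (simp add: integral_unique)
qed

lemma proximity_m_nonneg: "proximity_m r f \<ge> 0"
proof -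
  have "integral {0..2 * pi} (\<lambda>\<theta>. log_plus (norm (f (complex_of_real r * cis \<theta>)))) \<ge> 0"
    \<comment> \<open>In the non-integrable case the integral takes its default value 0.\<close>
    by (cases "(\<lambda>\<theta>. log_plus (norm (f (complex_of_real r * cis \<theta>)))) integrable_on {0..2 * pi}")
      (auto intro!: Henstock_Kurzweil_Integration.integral_nonneg
        simp: log_plus_def not_integrable_integral)
  thus ?thesis
    unfolding proximity_m_def by simp
qed

section \<open>A reciprocal Weierstrass product with prescribed pole orders\<close>

lemma card_floorlog_eq:
  assumes "k \<ge> 2"
  shows "card {n. floorlog 2 (n + 2) = k} = 2 ^ (k - 1)"
proof -
  \<comment> \<open>\<open>floorlog 2\<close> counts binary digits, so its fibres are dyadic blocks.
    The offset 2 skips 0 and 1, the only numbers with fewer than two digits.\<close>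
  have iff: "floorlog 2 (n + 2) = k \<longleftrightarrow> 2 ^ (k - 1) \<le> n + 2 \<and> n + 2 < 2 ^ k" for n
    using assms floorlog_bounds[of "n + 2" 2] floorlog_geI[of 2 k "n + 2"] floorlog_leI[of "n + 2" 2 k]
    by (auto intro: antisym)
  \<comment> \<open>This ensures that the natural-number subtractions of 2 below do not
    truncate.\<close>
  have pow: "(2::nat) ^ 1 \<le> 2 ^ (k - 1)"
    using assms by (intro power_increasing) auto
  have "{n. floorlog 2 (n + 2) = k} = {2 ^ (k - 1) - 2..<2 ^ k - 2}"
    unfolding set_eq_iff mem_Collect_eq atLeastLessThan_iff iff by linarith
  moreover have "(2::nat) ^ k = 2 * 2 ^ (k - 1)"
    using assms by (intro power_eq_if[THEN trans]) auto
  ultimately show ?thesis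
    using pow by simp
qed

text \<open>In a Weierstrass product, the order of a zero is the number of times it occurs in the
  sequence of zeros. The bit lengths of 2, 3, 4, ... list each k \<ge> 2 exactly
  \<open>2 ^ (k - 1)\<close> times and tend to infinity.\<close>

lemma exists_entire_zeros:
  "\<exists>W. W holomorphic_on UNIV \<and>
       (\<forall>z. W z = 0 \<longleftrightarrow> (\<exists>k\<ge>2. z = of_nat k)) \<and>
       (\<forall>k\<ge>2. isolated_zero W (of_nat k) \<and> zorder W (of_nat k) = 2 ^ (k - 1))"
proof -
  define a :: "nat \<Rightarrow> complex" where "a = (\<lambda>n. of_nat (floorlog 2 (n + 2)))"
  have ge2: "floorlog 2 (n + 2) \<ge> 2" for n
    using floorlog_geI[of 2 2 "n + 2"] by simp
  have norm_a: "norm (a n) = real (floorlog 2 (n + 2))" for n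
    by (simp add: a_def)
  have "filterlim (\<lambda>n. floorlog 2 (n + 2)) at_top at_top"
    unfolding filterlim_at_top
  proof
    fix k
    have "k \<le> floorlog 2 (n + 2)" if "n \<ge> 2 ^ k" for n
    proof -
      have "(2::nat) ^ (k - 1) \<le> 2 ^ k"
        by (intro power_increasing) auto
      thus ?thesis
        using that by (intro floorlog_geI) linarith+
    qed
    thus "\<forall>\<^sub>F n in sequentially. k \<le> floorlog 2 (n + 2)"
      by (auto simp: eventually_at_top_linorder)
  qed
  hence lim: "filterlim (\<lambda>n. norm (a n)) at_top at_top"
    unfolding norm_a by (rule filterlim_compose[OF filterlim_real_sequentially])
  \<comment> \<open>Taking \<open>n\<close> as the degree for the n-th factor works for any nonzero
    sequence tending to infinity: once \<open>norm (a n) \<ge> 2 * r\<close>, the n-th term is at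
    most \<open>(1 / 2) ^ Suc n\<close>.\<close>
  interpret weierstrass_product a "\<lambda>n. n"
  proof
    show "a n \<noteq> 0" for n
      using ge2[of n] norm_a[of n] by auto
    show "filterlim a at_infinity at_top"
      using lim by (rule filterlim_norm_at_top_imp_at_infinity)
    show "summable (\<lambda>n. (r / norm (a n)) ^ Suc n)" if "r > 0" for r
    proof (rule summable_comparison_test_ev)
      have "\<forall>\<^sub>F n in sequentially. norm (a n) \<ge> 2 * r"
        using lim by (auto simp: filterlim_at_top)
      thus "\<forall>\<^sub>F n in sequentially. norm ((r / norm (a n)) ^ Suc n) \<le> (1 / 2) ^ Suc n"
      proof eventually_elim
        case (elim n)
        hence "norm (r / norm (a n)) \<le> 1 / 2"
          using that by (auto simp: divide_le_eq)
        thus ?case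
          unfolding norm_power by (intro power_mono) auto
      qed
      show "summable (\<lambda>n. (1 / 2 :: real) ^ Suc n)"
        using summable_geometric[of "1 / 2 :: real"] by (subst summable_Suc_iff) simp
    qed
  qed
  have card: "card (a -` {of_nat k}) = 2 ^ (k - 1)" if "k \<ge> 2" for k
  proof -
    have "a -` {of_nat k} = {n. floorlog 2 (n + 2) = k}"
      by (auto simp: a_def)
    thus ?thesis using card_floorlog_eq[OF that] by simp
  qed
  have range: "z \<in> range a \<longleftrightarrow> (\<exists>k\<ge>2. z = of_nat k)" for z
  proof
    assume "\<exists>k\<ge>2. z = of_nat k"
    then obtain k where k: "k \<ge> 2" "z = of_nat k" by blast
    \<comment> \<open>The fibre has \<open>2 ^ (k - 1)\<close> elements, whereas the empty set has
      cardinality 0.\<close>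
    have "a -` {z} \<noteq> {}"
      using card[OF k(1)] k(2) by (intro notI) simp
    thus "z \<in> range a" by blast
  qed (use ge2 in \<open>auto simp: a_def\<close>)
  show ?thesis
  proof (intro exI[of _ f] conjI allI impI)
    show "f holomorphic_on UNIV" by (rule holomorphic)
    show "f z = 0 \<longleftrightarrow> (\<exists>k\<ge>2. z = of_nat k)" for z
      unfolding zero range ..
    show "isolated_zero f (of_nat k)" if "k \<ge> 2" for k
      using that range by (intro isolated_zero) auto
    show "zorder f (of_nat k) = 2 ^ (k - 1)" if "k \<ge> 2" for k
      using card[OF that] by (simp add: zorder)
  qed
qed

lemma exists_meromorphic_poles:
  "\<exists>f. f nicely_meromorphic_on UNIV \<and> poles_on_nat f (\<lambda>k. if k \<ge> 2 then 2 ^ (k - 1) else 0)"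
proof -
  obtain W where holo: "W holomorphic_on UNIV"
    and zero: "\<And>z. W z = 0 \<longleftrightarrow> (\<exists>k\<ge>2. z = of_nat k)"
    and iso: "\<And>k. k \<ge> 2 \<Longrightarrow> isolated_zero W (of_nat k)"
    and ord: "\<And>k. k \<ge> 2 \<Longrightarrow> zorder W (of_nat k) = 2 ^ (k - 1)"
    using exists_entire_zeros by blast
  have an: "W analytic_on A" for A
    using holo by (metis analytic_on_holomorphic analytic_on_subset open_UNIV subset_UNIV)
  define f where "f = (\<lambda>z. inverse (W z))"
  have pole: "is_pole f z \<longleftrightarrow> (\<exists>k\<ge>2. z = of_nat k)" for z
    unfolding f_def is_pole_inverse_iff
    using iso zero zero_isolated_zero_analytic[OF _ an] by blast
  have "f nicely_meromorphic_on UNIV"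
    unfolding nicely_meromorphic_on_def
  proof (intro conjI ballI)
    show "f meromorphic_on UNIV"
      unfolding f_def by (intro meromorphic_intros analytic_on_imp_meromorphic_on an)
    show "is_pole f z \<and> f z = 0 \<or> f \<midarrow>z\<rightarrow> f z" for z
    proof (cases "W z = 0")
      case True
      \<comment> \<open>Since \<open>inverse 0 = 0\<close>, \<open>f\<close> already has the value 0
        that \<open>nicely_meromorphic_on\<close> demands at a pole.\<close>
      thus ?thesis using pole zero by (simp add: f_def)
    next
      case False
      thus ?thesis
        unfolding f_def using analytic_at_imp_isCont[OF an]
        by (intro disjI2 tendsto_inverse) (auto simp: isCont_def)
    qed
  qed
  moreover have "zorder f (of_nat k) = - (2 ^ (k - 1))" if "k \<ge> 2" for k
  proof -
    have "zorder f (of_nat k) = - zorder W (of_nat k)"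
      unfolding f_def using iso[OF that]
      by (intro zorder_inverse isolated_singularity_at_analytic an isolated_zero_imp_not_essential
            eventually_frequently) (auto simp: isolated_zero_def)
    thus ?thesis using ord[OF that] by simp
  qed
  ultimately have "f nicely_meromorphic_on UNIV \<and>
      poles_on_nat f (\<lambda>k. if k \<ge> 2 then 2 ^ (k - 1) else 0)"
    unfolding poles_on_nat_def by (auto simp: pole split: if_splits)
  thus ?thesis by (rule exI[of _ f])
qed

section \<open>Infinite order from exponential growth of the counting function\<close>

lemma growth_order_eq_infinity:
  assumes "\<forall>\<^sub>F r in at_top. counting_N r f \<ge> c * exp (a * r)" "c > 0" "a > 0"
  shows "growth_order f = \<infinity>"
proof -
  have "filterlim (\<lambda>r. (ln c + a * r) / ln r) at_top at_top"
    using assms(3) by real_asymp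
  \<comment> \<open>As m(r, f) \<ge> 0, the bound on N passes to T, and its logarithm is linear in
    r. The quotient therefore has the limit \<infinity>, not merely the upper limit.\<close>
  moreover have "\<forall>\<^sub>F r in at_top. (ln c + a * r) / ln r \<le> log_plus (characteristic_T r f) / ln r"
    using assms(1) eventually_gt_at_top[of 1]
  proof eventually_elim
    case (elim r)
    have "c * exp (a * r) \<le> max 1 (characteristic_T r f)"
      using elim(1) proximity_m_nonneg[of r f] unfolding characteristic_T_def by simp
    hence "ln (c * exp (a * r)) \<le> log_plus (characteristic_T r f)"
      unfolding log_plus_def using assms(2) by (subst ln_le_cancel_iff) auto
    thus ?case
      using elim(2) assms(2) by (intro divide_right_mono) (auto simp: ln_mult)
  qed
  ultimately have "filterlim (\<lambda>r. log_plus (characteristic_T r f) / ln r) at_top at_top"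
    by (rule filterlim_at_top_mono)
  hence "((\<lambda>r. ereal (log_plus (characteristic_T r f) / ln r)) \<longlongrightarrow> \<infinity>) at_top"
    by (simp add: tendsto_PInfty_eq_at_top)
  thus ?thesis
    unfolding growth_order_def by (intro lim_imp_Limsup) auto
qed

section \<open>Comparison of the counting functions of \<open>f\<close> and its shift\<close>

theorem theorem2p3:
  shows "\<exists>f :: complex \<Rightarrow> complex.
           f nicely_meromorphic_on UNIV \<and>
           growth_order f = \<infinity> \<and>
           (\<forall>\<^sub>F r in at_top.
              (counting_N r (\<lambda>z. f (z + 1)) - counting_N r f) / counting_N r f \<ge> 1)"
proof -
  define m :: "nat \<Rightarrow> nat" where "m = (\<lambda>k. if k \<ge> 2 then 2 ^ (k - 1) else 0)"
  obtain f where f: "f nicely_meromorphic_on UNIV" "poles_on_nat f m"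
    using exists_meromorphic_poles unfolding m_def by blast
  \<comment> \<open>The poles start at 2 so that neither \<open>f\<close> nor its shift has a pole
    at the origin; the formula for N then applies to both.\<close>
  have m01: "m 0 = 0" "m (Suc 0) = 0"
    by (auto simp: m_def)
  have m_double: "2 * m k \<le> m (Suc k)" for k
    by (cases k) (auto simp: m_def)
  note N = counting_N_poles_on_nat[OF f(2) m01(1)]
  note N_shift = counting_N_poles_on_nat[OF poles_on_nat_shift[OF f(2) m01(1)] m01(2)]
  have ln_nonneg: "ln (r / real k) \<ge> 0" if "k \<in> {1..nat \<lfloor>r\<rfloor>}" for k r
  proof -
    have "1 \<le> k" "k \<le> nat \<lfloor>r\<rfloor>" using that by auto
    hence "real k \<le> r" "real k > 0" by linarith+
    thus ?thesis by simp
  qed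
  have lower: "counting_N r f \<ge> (ln 2 / 4) * exp (ln 2 / 2 * r)" if "r \<ge> 4" for r
  proof -
    \<comment> \<open>This pole balances both factors: k \<le> r / 2 gives
      \<open>ln (r / k) \<ge> ln 2\<close>, and k > r / 2 - 1 gives
      \<open>m k \<ge> 2 powr (r / 2 - 2)\<close>, whence the constants \<open>ln 2 / 4\<close> and
      \<open>ln 2 / 2\<close>. The bound r \<ge> 4 ensures k \<ge> 2.\<close>
    define k where "k = nat \<lfloor>r / 2\<rfloor>"
    have k: "k \<ge> 2" "real k \<le> r / 2" "real k > r / 2 - 1"
      unfolding k_def using that by linarith+
    have "(ln 2 / 4) * exp (ln 2 / 2 * r) = 2 powr (r / 2 - 2) * ln 2"
      by (simp add: powr_diff) (simp add: powr_def mult.commute)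
    also have "\<dots> \<le> 2 powr real (k - 1) * ln 2"
      using k by (intro mult_right_mono powr_mono) auto
    also have "\<dots> = real (m k) * ln 2"
      using k by (subst powr_realpow) (auto simp: m_def)
    also have "\<dots> \<le> real (m k) * ln (r / real k)"
      using k that by (intro mult_left_mono) (auto simp: field_simps)
    also have "\<dots> \<le> (\<Sum>k=1..nat \<lfloor>r\<rfloor>. real (m k) * ln (r / real k))"
    proof (rule member_le_sum)
      show "k \<in> {1..nat \<lfloor>r\<rfloor>}"
        using k(1,2) that by (auto simp: le_nat_floor)
    qed (use ln_nonneg in auto)
    also have "\<dots> = counting_N r f"
      using that by (simp add: N)
    finally show ?thesis .
  qed
  have "(counting_N r (\<lambda>z. f (z + 1)) - counting_N r f) / counting_N r f \<ge> 1" if "r \<ge> 4" for r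
  proof -
    have "2 * counting_N r f = (\<Sum>k=1..nat \<lfloor>r\<rfloor>. real (2 * m k) * ln (r / real k))"
      using that by (simp add: N sum_distrib_left mult.assoc)
    also have "\<dots> \<le> (\<Sum>k=1..nat \<lfloor>r\<rfloor>. real (m (Suc k)) * ln (r / real k))"
      using m_double ln_nonneg by (intro sum_mono mult_right_mono of_nat_mono) auto
    also have "\<dots> = counting_N r (\<lambda>z. f (z + 1))"
      using that by (simp add: N_shift)
    finally have "2 * counting_N r f \<le> counting_N r (\<lambda>z. f (z + 1))" .
    \<comment> \<open>Positivity allows the denominator to be cleared; it excludes the default value
      0 of a division by zero.\<close>
    moreover have "counting_N r f > 0"
      using lower[OF that] by (rule less_le_trans[rotated]) simp
    ultimately show ?thesis by (simp add: field_simps)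
  qed
  hence "\<forall>\<^sub>F r in at_top. (counting_N r (\<lambda>z. f (z + 1)) - counting_N r f) / counting_N r f \<ge> 1"
    by (auto simp: eventually_at_top_linorder)
  moreover have "growth_order f = \<infinity>"
    using lower by (intro growth_order_eq_infinity[of "ln 2 / 4" "ln 2 / 2"])
      (auto simp: eventually_at_top_linorder)
  ultimately show ?thesis using f(1) by blast
qed

end
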